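(* Let $Q^T\tau$ be a system of $s$ pairwise comparisons of $v$ treatments and let $G$ be the corresponding graph. Suppose that there exists a cyclic permutation $\pi$ of $\{1,\ldots,v\}$ which is an automorphism of $G$. Then $\bar w=1_v/v$ is $\Phi$-optimal for estimating $Q^T\tau$ with respect to any orthogonally invariant information function $\Phi$.
   Context: A system of $s$ pairwise comparisons $Q^T\tau$ is given by a $v\times s$ matrix $Q$ every column of which represents a difference $\tau_j-\tau_i$ with $i\ne j$ (entry $1$ in row $j$, $-1$ in row $i$, zeros elsewhere), different columns corresponding to different unordered pairs $\{i,j\}$; no row of $Q$ is zero; $r=\mathrm{rank}(Q)$. The system is full-rank if $s\le v$ and $r=s$, otherwise rank deficient. The corresponding directed graph $G=(V,E)$ has $V=\{1,\ldots,v\}$ and an edge $(j,i)$ for each comparison $\tau_j-\tau_i$ in the system. An automorphism of $G$ is a bijection $\pi:V\to V$ with $(i,j)\in E$ if and only if $(\pi(i),\pi(j))\in E$. A permutation $\pi$ of $V$ is cyclic if it consists of only one cycle, i.e. for any $i,j\in V$ there is $m\in\mathbb{N}$ with $\pi^m(i)=j$. A design is $w=(w_1,\ldots,w_v)^T$ with $w_i\in[0,1]$, $\sum_iw_i=1$; it is feasible if and only if $w_i>0$ for all $i$ (written $w>0$). $M(w)=\mathrm{diag}(w)$. For $w>0$, $N_Q(w)=(Q^TM^{-1}(w)Q)^{-1}$ in the full-rank case and $C_Q(w)=(Q^TM^{-1}(w)Q)^+$ (Moore-Penrose pseudoinverse) in the rank deficient case. An information function $\Phi$ is a real function on $s\times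 s$ non-negative definite matrices that is positively homogeneous, superadditive, Loewner isotonic, concave and upper semicontinuous; it is orthogonally invariant if $\Phi(UHU^T)=\Phi(H)$ for every orthogonal $U$. A design is $\Phi$-optimal for $Q^T\tau$ if it maximizes $\Phi(N_Q(w))$ (full-rank case), respectively $\Phi(C_Q(w))$ (rank deficient case), over all designs $w>0$. *)

theory Defs
  imports "HOL-Analysis.Analysis"
begin

text \<open>The treatments are the elements of a finite type \<open>'v\<close> (so \<open>v = CARD('v)\<close>) and the
  comparisons those of a finite type \<open>'s\<close> (so \<open>s = CARD('s)\<close>); a \<open>v \<times> s\<close> matrix has the type
  \<open>real ^ 's ^ 'v\<close>.\<close>

section \<open>Matrices\<close>

definition diag_matrix :: "real ^ 'n \<Rightarrow> real ^ 'n ^ 'n" where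
  "diag_matrix w = (\<chi> i j. if i = j then w $ i else 0)"

definition is_pseudoinverse :: "real ^ 'n ^ 'm \<Rightarrow> real ^ 'm ^ 'n \<Rightarrow> bool" where
  "is_pseudoinverse A X \<longleftrightarrow>
     A ** X ** A = A \<and> X ** A ** X = X \<and>
     transpose (A ** X) = A ** X \<and> transpose (X ** A) = X ** A"

text \<open>The Moore-Penrose pseudoinverse; every real matrix has exactly one.\<close>

definition pseudoinverse :: "real ^ 'n ^ 'm \<Rightarrow> real ^ 'm ^ 'n" where
  "pseudoinverse A = (THE X. is_pseudoinverse A X)"

definition nonneg_definite :: "real ^ 'n ^ 'n \<Rightarrow> bool" where
  "nonneg_definite A \<longleftrightarrow> transpose A = A \<and> (\<forall>x. 0 \<le> x \<bullet> (A *v x))"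

definition loewner_le :: "real ^ 'n ^ 'n \<Rightarrow> real ^ 'n ^ 'n \<Rightarrow> bool" where
  "loewner_le A B \<longleftrightarrow> nonneg_definite (B - A)"

section \<open>Systems of pairwise comparisons\<close>

definition is_comparison :: "real ^ 'v \<Rightarrow> 'v \<Rightarrow> 'v \<Rightarrow> bool" where
  "is_comparison q j i \<longleftrightarrow> i \<noteq> j \<and> q = axis j 1 - axis i 1"

definition pairwise_comparisons :: "real ^ 's ^ 'v \<Rightarrow> bool" where
  "pairwise_comparisons Q \<longleftrightarrow>
     (\<forall>k. \<exists>i j. is_comparison (column k Q) j i) \<and>
     (\<forall>k l i j i' j'. k \<noteq> l \<longrightarrow> is_comparison (column k Q) j i \<longrightarrow>
        is_comparison (column l Q) j' i' \<longrightarrow> {i, j} \<noteq> {i', j'}) \<and>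
     (\<forall>i. row i Q \<noteq> 0)"

definition full_rank_system :: "real ^ 's ^ 'v \<Rightarrow> bool" where
  "full_rank_system Q \<longleftrightarrow> CARD('s) \<le> CARD('v) \<and> rank Q = CARD('s)"

definition comparison_edges :: "real ^ 's ^ 'v \<Rightarrow> ('v \<times> 'v) set" where
  "comparison_edges Q = {(j, i). \<exists>k. is_comparison (column k Q) j i}"

definition graph_automorphism :: "('v \<times> 'v) set \<Rightarrow> ('v \<Rightarrow> 'v) \<Rightarrow> bool" where
  "graph_automorphism E \<pi> \<longleftrightarrow> bij \<pi> \<and> (\<forall>i j. (i, j) \<in> E \<longleftrightarrow> (\<pi> i, \<pi> j) \<in> E)"

definition cyclic_permutation :: "('v \<Rightarrow> 'v) \<Rightarrow> bool" where
  "cyclic_permutation \<pi> \<longleftrightarrow> bij \<pi> \<and> (\<forall>i j. \<exists>m. (\<pi> ^^ m) i = j)"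

section \<open>Designs and optimality\<close>

definition design :: "real ^ 'v \<Rightarrow> bool" where
  "design w \<longleftrightarrow> (\<forall>i. w $ i \<in> {0..1}) \<and> (\<Sum>i\<in>UNIV. w $ i) = 1"

definition positive_design :: "real ^ 'v \<Rightarrow> bool" where
  "positive_design w \<longleftrightarrow> design w \<and> (\<forall>i. 0 < w $ i)"

definition uniform_design :: "real ^ 'v" where
  "uniform_design = (\<chi> i. 1 / real CARD('v))"

definition N_mat :: "real ^ 's ^ 'v \<Rightarrow> real ^ 'v \<Rightarrow> real ^ 's ^ 's" where
  "N_mat Q w = matrix_inv (transpose Q ** matrix_inv (diag_matrix w) ** Q)"

definition C_mat :: "real ^ 's ^ 'v \<Rightarrow> real ^ 'v \<Rightarrow> real ^ 's ^ 's" where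
  "C_mat Q w = pseudoinverse (transpose Q ** matrix_inv (diag_matrix w) ** Q)"

definition information_matrix :: "real ^ 's ^ 'v \<Rightarrow> real ^ 'v \<Rightarrow> real ^ 's ^ 's" where
  "information_matrix Q w = (if full_rank_system Q then N_mat Q w else C_mat Q w)"

definition upper_semicontinuous_on :: "'a::topological_space set \<Rightarrow> ('a \<Rightarrow> real) \<Rightarrow> bool" where
  "upper_semicontinuous_on S f \<longleftrightarrow>
     (\<forall>x\<in>S. \<forall>c. f x < c \<longrightarrow> (\<forall>\<^sub>F y in at x within S. f y < c))"

text \<open>Only the values on non-negative definite matrices matter below; the values of \<open>\<Phi>\<close> on all
  other matrices are unconstrained.\<close>

definition information_function :: "(real ^ 's ^ 's \<Rightarrow> real) \<Rightarrow> bool" where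
  "information_function \<Phi> \<longleftrightarrow>
     (\<forall>H a. nonneg_definite H \<longrightarrow> 0 < a \<longrightarrow> \<Phi> (a *\<^sub>R H) = a * \<Phi> H) \<and>
     (\<forall>G H. nonneg_definite G \<longrightarrow> nonneg_definite H \<longrightarrow> \<Phi> G + \<Phi> H \<le> \<Phi> (G + H)) \<and>
     (\<forall>G H. nonneg_definite G \<longrightarrow> nonneg_definite H \<longrightarrow> loewner_le G H \<longrightarrow> \<Phi> G \<le> \<Phi> H) \<and>
     concave_on {H. nonneg_definite H} \<Phi> \<and>
     upper_semicontinuous_on {H. nonneg_definite H} \<Phi>"

definition orthogonally_invariant :: "(real ^ 's ^ 's \<Rightarrow> real) \<Rightarrow> bool" where
  "orthogonally_invariant \<Phi> \<longleftrightarrow>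
     (\<forall>H U. nonneg_definite H \<longrightarrow> orthogonal_matrix U \<longrightarrow> \<Phi> (U ** H ** transpose U) = \<Phi> H)"

definition optimal_design ::
    "(real ^ 's ^ 's \<Rightarrow> real) \<Rightarrow> real ^ 's ^ 'v \<Rightarrow> real ^ 'v \<Rightarrow> bool" where
  "optimal_design \<Phi> Q w \<longleftrightarrow> positive_design w \<and>
     (\<forall>w'. positive_design w' \<longrightarrow>
        \<Phi> (information_matrix Q w') \<le> \<Phi> (information_matrix Q w))"

end

theory Submission
  imports Defs
begin

text \<open>Write \<open>A w = Q\<^sup>T M(w)\<^sup>-\<^sup>1 Q\<close>. In both cases the information matrix \<open>C w\<close> is the pseudoinverse of
  \<open>A w\<close>, and \<open>A w C w\<close> is the orthogonal projection onto the row space of \<open>Q\<close>, whatever \<open>w > 0\<close> is.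
  Therefore \<open>x\<^sup>T (C w) x\<close> is the minimum of \<open>z\<^sup>T M(w) z\<close> over all \<open>z\<close> for which \<open>Q\<^sup>T z\<close> is the
  projection of \<open>x\<close>. Taking the minimizer \<open>z\<close> for the uniform design as a competitor for the shifted
  designs \<open>w \<circ> \<pi>\<^sup>m\<close>, \<open>m < N\<close>, whose average is uniform when \<open>\<pi>\<^sup>N = id\<close>, shows
  that \<open>\<Sum>m<N. C (w \<circ> \<pi>\<^sup>m)\<close> is Loewner-below \<open>N C (1\<^sub>v/v)\<close>. Since \<open>\<pi>\<close> permutes the columns of \<open>Q\<close>,
  all summands are orthogonally similar to \<open>C w\<close>, and superadditivity finishes the argument.\<close>

section \<open>Pseudoinverses\<close>

text \<open>\<open>A ** X\<close> and \<open>A ** Y\<close> are symmetric and absorb each other,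
  hence equal; likewise \<open>X ** A\<close> and \<open>Y ** A\<close>. Then
  \<open>X = X ** A ** X = Y ** A ** Y = Y\<close>.\<close>

lemma is_pseudoinverse_unique:
  fixes A :: "real ^ 'n ^ 'm"
  assumes X: "is_pseudoinverse A X" and Y: "is_pseudoinverse A Y"
  shows "X = Y"
proof -
  note x = X[unfolded is_pseudoinverse_def] and y = Y[unfolded is_pseudoinverse_def]
  have AX: "A ** X = A ** Y"
  proof -
    have "A ** X = (A ** Y) ** (A ** X)"
      using y by (simp add: matrix_mul_assoc)
    then have "transpose (A ** X) = transpose (A ** X) ** transpose (A ** Y)"
      by (metis matrix_transpose_mul)
    then have "A ** X = (A ** X) ** (A ** Y)"
      using x y by simp
    then show ?thesis
      using x by (simp add: matrix_mul_assoc)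
  qed
  have XA: "X ** A = Y ** A"
  proof -
    have "X ** A = (X ** A) ** (Y ** A)"
      using y by (simp flip: matrix_mul_assoc)
    then have "transpose (X ** A) = transpose (Y ** A) ** transpose (X ** A)"
      by (metis matrix_transpose_mul)
    then have "X ** A = (Y ** A) ** (X ** A)"
      using x y by simp
    then show ?thesis
      using x by (simp flip: matrix_mul_assoc)
  qed
  have "X = X ** (A ** X)"
    using x by (simp add: matrix_mul_assoc)
  also have "\<dots> = Y ** A ** Y"
    by (simp add: AX XA matrix_mul_assoc)
  finally show ?thesis
    using y by simp
qed

lemma pseudoinverse_eqI:
  "is_pseudoinverse A X \<Longrightarrow> pseudoinverse A = X"
  unfolding pseudoinverse_def by (rule the_equality) (assumption, rule is_pseudoinverse_unique)

text \<open>The matrix of the Fourier expansion in an orthonormal basis of \<open>S\<close>.\<close>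

lemma orthogonal_projection_exists:
  fixes S :: "(real ^ 'n) set"
  assumes "subspace S"
  obtains P :: "real ^ 'n ^ 'n"
  where "transpose P = P" "\<And>x. P *v x \<in> S" "\<And>x. x \<in> S \<Longrightarrow> P *v x = x"
    "\<And>x y. y \<in> S \<Longrightarrow> y \<bullet> (x - P *v x) = 0"
proof -
  obtain B where B: "B \<subseteq> S" "pairwise orthogonal B" "\<And>b. b \<in> B \<Longrightarrow> norm b = 1"
    "independent B" "span B = S"
    using orthonormal_basis_subspace[OF assms] by metis
  have fin: "finite B"
    using B(4) independent_imp_finite by blast
  define p where "p x = (\<Sum>b\<in>B. (x \<bullet> b) *\<^sub>R b)" for x
  have "linear p"
    by (rule linearI)
      (auto simp: p_def inner_add_left scaleR_add_left sum.distrib scaleR_sum_right)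
  then have P: "matrix p *v x = p x" for x
    by simp
  have fixed: "p x = x" if "x \<in> S" for x
    unfolding p_def by (rule orthonormal_basis_expand) (use B fin that in auto)
  have symm: "x \<bullet> p y = y \<bullet> p x" for x y
    by (simp add: p_def inner_sum_right inner_commute mult.commute)
  have "transpose (matrix p) = matrix p"
    by (simp add: matrix_def transpose_def vec_eq_iff)
      (metis symm inner_axis inner_commute inner_real_def mult.right_neutral)
  moreover have "p x \<in> S" for x
    unfolding p_def B(5)[symmetric] by (simp add: span_base span_mul span_sum)
  moreover have "y \<bullet> (x - p x) = 0" if "y \<in> S" for x y
    using symm[of y x] fixed[OF that] by (simp add: inner_diff_right inner_commute)
  ultimately show thesis
    using that[of "matrix p"] fixed P by auto
qed

lemma transpose_dot:
  fixes A :: "real ^ 'n ^ 'm"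
  shows "(transpose A *v x) \<bullet> y = x \<bullet> (A *v y)"
  by (simp add: dot_lmul_matrix)

text \<open>If \<open>P\<close> projects orthogonally onto the range of \<open>A\<close>, then
  \<open>A + mat 1 - P\<close> has an inverse \<open>D\<close>, and \<open>D ** P\<close> is the
  pseudoinverse: its products with \<open>A\<close> in both orders are \<open>P\<close>.\<close>

lemma symmetric_has_pseudoinverse:
  fixes A :: "real ^ 'n ^ 'n"
  assumes "transpose A = A"
  shows "\<exists>X. is_pseudoinverse A X"
proof -
  have "subspace (range ((*v) A))"
    by (metis linear_subspace_image matrix_vector_mul_linear subspace_UNIV)
  then obtain P :: "real ^ 'n ^ 'n" where P: "transpose P = P" "\<And>x. P *v x \<in> range ((*v) A)"
    "\<And>x. x \<in> range ((*v) A) \<Longrightarrow> P *v x = x"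
    "\<And>x y. y \<in> range ((*v) A) \<Longrightarrow> y \<bullet> (x - P *v x) = 0"
    using orthogonal_projection_exists by blast
  have PA: "P ** A = A" and PP: "P ** P = P"
    by (simp_all add: matrix_eq P flip: matrix_vector_mul_assoc)
  have AP: "A ** P = A"
    by (metis PA P(1) assms matrix_transpose_mul)
  \<comment> \<open>\<open>B\<close> acts as \<open>A\<close> on the range of \<open>A\<close> and
    as the identity on the orthogonal complement, which by symmetry is the kernel of
    \<open>A\<close>.\<close>
  define B where "B = A + mat 1 - P"
  have Bv: "B *v x = A *v x + (x - P *v x)" for x
    by (simp add: B_def algebra_simps)
  have "x = 0" if "B *v x = 0" for x
  proof -
    \<comment> \<open>Two orthogonal vectors that cancel are both zero; so \<open>x\<close> lies in
      the range and in the kernel of \<open>A\<close>, which are orthogonal.\<close>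
    have *: "A *v x = - (x - P *v x)"
      using that unfolding Bv by (simp only: eq_neg_iff_add_eq_0)
    have "(A *v x) \<bullet> (x - P *v x) = 0"
      by (simp add: P(4))
    then have "(x - P *v x) \<bullet> (x - P *v x) = 0"
      unfolding * by (simp only: inner_minus_left neg_equal_0_iff_equal)
    then have xP: "x - P *v x = 0"
      by (simp only: inner_eq_zero_iff)
    then have "A *v x = 0"
      unfolding * by (simp only: neg_equal_0_iff_equal)
    obtain y where "P *v x = A *v y"
      using P(2) by blast
    then have y: "x = A *v y"
      using xP by (simp only: right_minus_eq)
    have "x \<bullet> x = y \<bullet> (A *v x)"
      using transpose_dot[of A y x] unfolding assms y[symmetric] .
    also have "\<dots> = 0"
      using \<open>A *v x = 0\<close> by (simp only: inner_zero_right)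
    finally show ?thesis
      by simp
  qed
  then obtain D where D: "D ** B = mat 1" "B ** D = mat 1"
    by (metis matrix_left_invertible_ker matrix_left_right_inverse)
  have BP: "B ** P = A"
    by (simp add: matrix_eq Bv flip: matrix_vector_mul_assoc)
      (simp add: matrix_vector_mul_assoc AP PP)
  have PB: "P ** B = A"
  proof -
    have "P *v (B *v x) = A *v x" for x
      unfolding Bv by (simp add: algebra_simps) (simp add: matrix_vector_mul_assoc PA PP)
    then show ?thesis
      by (simp add: matrix_eq flip: matrix_vector_mul_assoc)
  qed
  have DA: "D ** A = P"
    by (metis BP D(1) matrix_mul_assoc matrix_mul_lid)
  have AD: "A ** D = P"
    by (metis PB D(2) matrix_mul_assoc matrix_mul_rid)
  have "is_pseudoinverse A (D ** P)"
  proof -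
    have "A ** (D ** P) = P"
      by (simp add: matrix_mul_assoc AD PP)
    moreover have "(D ** P) ** A = P"
      by (simp add: PA DA flip: matrix_mul_assoc)
    moreover have "P ** (D ** P) = D ** P"
      by (metis AD DA PP matrix_mul_assoc)
    ultimately show ?thesis
      by (simp add: is_pseudoinverse_def P(1) PA)
  qed
  then show ?thesis ..
qed

section \<open>Symmetry, definiteness and orthogonal conjugation of pseudoinverses\<close>

text \<open>Transposing the Penrose equations shows that \<open>transpose X\<close> is a
  pseudoinverse of \<open>A\<close> too.\<close>

lemma pseudoinverse_symmetric:
  fixes A :: "real ^ 'n ^ 'n"
  assumes "transpose A = A" "is_pseudoinverse A X"
  shows "transpose X = X"
proof (rule is_pseudoinverse_unique[OF _ assms(2)])
  note x = assms(2)[unfolded is_pseudoinverse_def]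
  have "A ** transpose X = X ** A" "transpose X ** A = A ** X"
    by (metis assms(1) matrix_transpose_mul x)+
  moreover have "A ** transpose X ** A = A" "transpose X ** A ** transpose X = transpose X"
    by (metis assms(1) matrix_transpose_mul matrix_mul_assoc x)+
  ultimately show "is_pseudoinverse A (transpose X)"
    using x by (simp add: is_pseudoinverse_def)
qed

text \<open>From \<open>X = X ** A ** X\<close> and the symmetry of \<open>X\<close>, the form of
  \<open>X\<close> at \<open>x\<close> is the form of \<open>A\<close> at
  \<open>X *v x\<close>.\<close>

lemma pseudoinverse_nonneg_definite:
  fixes A :: "real ^ 'n ^ 'n"
  assumes "nonneg_definite A" "is_pseudoinverse A X"
  shows "nonneg_definite X"
  unfolding nonneg_definite_def
proof (intro conjI allI)
  have sX: "transpose X = X"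
    using assms pseudoinverse_symmetric unfolding nonneg_definite_def by blast
  then show "transpose X = X" .
  fix x :: "real ^ 'n"
  have "x \<bullet> (X *v x) = x \<bullet> (X *v (A *v (X *v x)))"
    using assms(2) by (simp add: is_pseudoinverse_def matrix_vector_mul_assoc matrix_mul_assoc)
  also have "\<dots> = (X *v x) \<bullet> (A *v (X *v x))"
    using transpose_dot[of X x] sX by simp
  finally show "0 \<le> x \<bullet> (X *v x)"
    using assms(1) by (simp add: nonneg_definite_def)
qed

text \<open>Conjugation by \<open>U\<close> respects products and transposes, hence the Penrose
  equations.\<close>

lemma is_pseudoinverse_orthogonal_similar:
  fixes A :: "real ^ 'n ^ 'n"
  assumes "orthogonal_matrix U" "is_pseudoinverse A X"
  shows "is_pseudoinverse (U ** A ** transpose U) (U ** X ** transpose U)"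
proof -
  have [simp]: "M ** transpose U ** U = M" for M :: "real ^ 'n ^ 'n"
    using assms(1) by (simp add: orthogonal_matrix_def flip: matrix_mul_assoc)
  note x = assms(2)[unfolded is_pseudoinverse_def]
  have mult: "(U ** G ** transpose U) ** (U ** H ** transpose U) = U ** (G ** H) ** transpose U"
    for G H
    by (simp add: matrix_mul_assoc)
  have transp: "transpose (U ** G ** transpose U) = U ** transpose G ** transpose U" for G
    by (simp add: matrix_transpose_mul matrix_mul_assoc)
  show ?thesis
    unfolding is_pseudoinverse_def mult transp using x by simp
qed

section \<open>The information matrix\<close>

text \<open>The \<open>A w\<close> of the overview, the common argument of the inverse in
  \<open>N_mat\<close> and the pseudoinverse in \<open>C_mat\<close>.\<close>

definition moment_matrix :: "real ^ 's ^ 'v \<Rightarrow> real ^ 'v \<Rightarrow> real ^ 's ^ 's" where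
  "moment_matrix Q w = transpose Q ** matrix_inv (diag_matrix w) ** Q"

lemma matrix_inv_eqI:
  fixes A B :: "real ^ 'n ^ 'n"
  assumes "A ** B = mat 1"
  shows "matrix_inv A = B"
proof -
  have BA: "B ** A = mat 1"
    using assms matrix_left_right_inverse by blast
  have "A ** matrix_inv A = mat 1"
    unfolding matrix_inv_def by (rule someI2[of _ B]) (use assms BA in auto)
  then show ?thesis
    by (metis BA matrix_mul_assoc matrix_mul_lid matrix_mul_rid)
qed

lemma diag_matrix_vector_mult: "(diag_matrix w *v x) $ i = w $ i * x $ i"
  by (simp add: diag_matrix_def matrix_vector_mult_def if_distrib if_distribR cong: if_cong)

lemma matrix_inv_diag_matrix:
  fixes w :: "real ^ 'n"
  assumes "\<And>i. 0 < w $ i"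
  shows "matrix_inv (diag_matrix w) = diag_matrix (\<chi> i. inverse (w $ i))"
proof (rule matrix_inv_eqI)
  have "w $ i \<noteq> 0" for i
    using assms[of i] by simp
  then show "diag_matrix w ** diag_matrix (\<chi> i. inverse (w $ i)) = mat 1"
    by (simp add: matrix_eq vec_eq_iff diag_matrix_vector_mult flip: matrix_vector_mul_assoc)
qed

lemma moment_matrix_vector_mult:
  assumes "\<And>i. 0 < w $ i"
  shows "moment_matrix Q w *v x = transpose Q *v (\<chi> i. (Q *v x) $ i / w $ i)"
proof -
  have "diag_matrix (\<chi> i. inverse (w $ i)) *v (Q *v x) = (\<chi> i. (Q *v x) $ i / w $ i)"
    by (simp add: vec_eq_iff diag_matrix_vector_mult divide_inverse mult.commute)
  then show ?thesis
    by (simp add: moment_matrix_def matrix_inv_diag_matrix assms flip: matrix_vector_mul_assoc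
        del: transpose_matrix_vector)
qed

lemma moment_matrix_quadratic_form:
  assumes "\<And>i. 0 < w $ i"
  shows "x \<bullet> (moment_matrix Q w *v x) = (\<Sum>i\<in>UNIV. ((Q *v x) $ i)\<^sup>2 / w $ i)"
  unfolding inner_commute[of x] moment_matrix_vector_mult[OF assms] transpose_dot
  by (simp add: inner_vec_def power2_eq_square)

lemma moment_matrix_entry:
  assumes "\<And>i. 0 < w $ i"
  shows "moment_matrix Q w $ k $ l = (\<Sum>i\<in>UNIV. Q $ i $ k * Q $ i $ l / w $ i)"
proof -
  have "(transpose Q ** diag_matrix (\<chi> i. inverse (w $ i))) $ k $ i = Q $ i $ k / w $ i" for i
    by (simp add: matrix_matrix_mult_def diag_matrix_def transpose_def divide_inverse
        if_distrib if_distribR cong: if_cong)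
  then show ?thesis
    unfolding moment_matrix_def matrix_inv_diag_matrix[OF assms]
    by (subst matrix_matrix_mult_def) simp
qed

lemma moment_matrix_nonneg_definite:
  assumes "\<And>i. 0 < w $ i"
  shows "nonneg_definite (moment_matrix Q w)"
  unfolding nonneg_definite_def
proof (intro conjI allI)
  show "transpose (moment_matrix Q w) = moment_matrix Q w"
    by (simp add: transpose_def vec_eq_iff moment_matrix_entry assms mult.commute)
  show "0 \<le> x \<bullet> (moment_matrix Q w *v x)" for x
    unfolding moment_matrix_quadratic_form[OF assms]
    by (intro sum_nonneg divide_nonneg_pos assms) auto
qed

text \<open>A sum of squares with positive weights vanishes only termwise. The kernel therefore does
  not depend on \<open>w\<close>, which makes different designs comparable.\<close>

lemma moment_matrix_kernel:
  assumes "\<And>i. 0 < w $ i"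
  shows "moment_matrix Q w *v x = 0 \<longleftrightarrow> Q *v x = 0"
proof
  assume "moment_matrix Q w *v x = 0"
  then have "(\<Sum>i\<in>UNIV. ((Q *v x) $ i)\<^sup>2 / w $ i) = 0"
    using moment_matrix_quadratic_form[OF assms, of x Q] by simp
  moreover have "0 \<le> ((Q *v x) $ i)\<^sup>2 / w $ i" for i
    by (intro divide_nonneg_pos assms) auto
  ultimately have "((Q *v x) $ i)\<^sup>2 / w $ i = 0" for i
    by (subst (asm) sum_nonneg_eq_0_iff) auto
  then have "(Q *v x) $ i = 0" for i
    using assms[of i] by (metis divide_eq_0_iff less_irrefl power_eq_0_iff)
  then show "Q *v x = 0"
    by (simp add: vec_eq_iff)
next
  assume "Q *v x = 0"
  then show "moment_matrix Q w *v x = 0"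
    by (simp add: moment_matrix_def flip: matrix_vector_mul_assoc)
qed

section \<open>The information matrix as a pseudoinverse, with one projection for all
  designs\<close>

text \<open>Full rank makes \<open>Q\<close> injective and the moment matrix invertible, so its
  inverse is its pseudoinverse. This unifies the two cases for all that follows.\<close>

lemma information_matrix_is_pseudoinverse:
  assumes "\<And>i. 0 < w $ i"
  shows "is_pseudoinverse (moment_matrix Q w) (information_matrix Q w)"
proof (cases "full_rank_system Q")
  case True
  then have "inj ((*v) Q)"
    by (simp add: full_rank_system_def full_rank_injective)
  then have "x = 0" if "moment_matrix Q w *v x = 0" for x
    using that by (simp add: moment_matrix_kernel[OF assms]) (metis injD matrix_vector_mult_0_right)
  then obtain D where D: "D ** moment_matrix Q w = mat 1" "moment_matrix Q w ** D = mat 1"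
    by (metis matrix_left_invertible_ker matrix_left_right_inverse)
  have "information_matrix Q w = D"
    using True matrix_inv_eqI[OF D(2)]
    by (simp add: information_matrix_def N_mat_def moment_matrix_def)
  with D show ?thesis
    by (simp add: is_pseudoinverse_def)
next
  case False
  obtain X where "is_pseudoinverse (moment_matrix Q w) X"
    using symmetric_has_pseudoinverse moment_matrix_nonneg_definite[OF assms]
    unfolding nonneg_definite_def by metis
  with False pseudoinverse_eqI[OF this] show ?thesis
    by (simp add: information_matrix_def C_mat_def moment_matrix_def)
qed

lemma information_matrix_nonneg_definite:
  assumes "\<And>i. 0 < w $ i"
  shows "nonneg_definite (information_matrix Q w)"
  by (rule pseudoinverse_nonneg_definite[OF moment_matrix_nonneg_definite[OF assms]
        information_matrix_is_pseudoinverse[OF assms]])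

text \<open>The complement of the projection for \<open>w'\<close> maps into the kernel of the
  moment matrix of \<open>w'\<close>, which is also that of \<open>w\<close>.\<close>

lemma moment_information_projection_absorb:
  assumes w: "\<And>i. 0 < w $ i" and w': "\<And>i. 0 < w' $ i"
  shows "(information_matrix Q w ** moment_matrix Q w) **
    (information_matrix Q w' ** moment_matrix Q w') = information_matrix Q w ** moment_matrix Q w"
proof -
  let ?P' = "information_matrix Q w' ** moment_matrix Q w'"
  have "moment_matrix Q w' ** ?P' = moment_matrix Q w'"
    using information_matrix_is_pseudoinverse[OF w', of Q]
    by (simp add: is_pseudoinverse_def matrix_mul_assoc)
  then have "moment_matrix Q w' *v (x - ?P' *v x) = 0" for x
    by (simp add: matrix_vector_mult_diff_distrib) (simp add: matrix_vector_mul_assoc)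
  then have "moment_matrix Q w *v (x - ?P' *v x) = 0" for x
    by (simp only: moment_matrix_kernel[OF w] moment_matrix_kernel[OF w'])
  then have "moment_matrix Q w ** ?P' = moment_matrix Q w"
    by (simp add: matrix_eq matrix_vector_mult_diff_distrib flip: matrix_vector_mul_assoc)
  then show ?thesis
    by (simp flip: matrix_mul_assoc)
qed

text \<open>Symmetric projections that absorb each other coincide, as transposing one absorption law
  shows. Each moment matrix commutes with its information matrix, so the order of the factors is
  immaterial.\<close>

lemma moment_information_projection_eq:
  assumes w: "\<And>i. 0 < w $ i" and w': "\<And>i. 0 < w' $ i"
  shows "moment_matrix Q w ** information_matrix Q w = moment_matrix Q w' ** information_matrix Q w'"
proof -
  have comm: "moment_matrix Q u ** information_matrix Q u = information_matrix Q u ** moment_matrix Q u"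
      and symm: "transpose (information_matrix Q u ** moment_matrix Q u) =
        information_matrix Q u ** moment_matrix Q u"
    if "\<And>i. 0 < u $ i" for u
  proof -
    note u = information_matrix_is_pseudoinverse[OF that, of Q]
    show symm: "transpose (information_matrix Q u ** moment_matrix Q u) =
        information_matrix Q u ** moment_matrix Q u"
      using u by (simp add: is_pseudoinverse_def)
    show "moment_matrix Q u ** information_matrix Q u = information_matrix Q u ** moment_matrix Q u"
      using symm moment_matrix_nonneg_definite[OF that, of Q]
        information_matrix_nonneg_definite[OF that, of Q]
      by (simp add: nonneg_definite_def matrix_transpose_mul)
  qed
  show ?thesis
    unfolding comm[OF w] comm[OF w']
    by (metis (no_types) moment_information_projection_absorb[OF w w', of Q]
        moment_information_projection_absorb[OF w' w, of Q] symm[OF w] symm[OF w'] matrix_transpose_mul)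
qed

section \<open>Variational description of the information matrix\<close>

lemma information_matrix_quadratic_form:
  fixes x :: "real ^ 's"
  assumes w: "\<And>i. 0 < w $ i"
  shows "x \<bullet> (information_matrix Q w *v x) =
    (information_matrix Q w *v x) \<bullet> (moment_matrix Q w *v (information_matrix Q w *v x))"
proof -
  define y where "y = information_matrix Q w *v x"
  have "x \<bullet> y = x \<bullet> (information_matrix Q w *v (moment_matrix Q w *v y))"
    using information_matrix_is_pseudoinverse[OF w, of Q]
    by (simp add: y_def is_pseudoinverse_def matrix_vector_mul_assoc matrix_mul_assoc)
  also have "\<dots> = y \<bullet> (moment_matrix Q w *v y)"
    using information_matrix_nonneg_definite[OF w, of Q]
      transpose_dot[of "information_matrix Q w" x "moment_matrix Q w *v y"]
    by (simp add: nonneg_definite_def y_def)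
  finally show ?thesis
    by (simp add: y_def)
qed

text \<open>Put \<open>u = Q *v y\<close> with \<open>y = information_matrix Q w *v x\<close>.
  Expanding the squares of \<open>w $ i * z $ i - u $ i\<close>, divided by \<open>w $ i\<close>,
  gives the bound, since the cross term and the \<open>u\<close> term both sum to multiples of
  \<open>x \<bullet> y\<close>.\<close>

lemma information_matrix_le_quadratic_form:
  assumes w: "\<And>i. 0 < w $ i"
    and z: "transpose Q *v z = moment_matrix Q w *v (information_matrix Q w *v x)"
  shows "x \<bullet> (information_matrix Q w *v x) \<le> (\<Sum>i\<in>UNIV. w $ i * (z $ i)\<^sup>2)"
proof -
  define y where "y = information_matrix Q w *v x"
  define u where "u = Q *v y"
  have xy: "x \<bullet> y = y \<bullet> (moment_matrix Q w *v y)"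
    unfolding y_def by (rule information_matrix_quadratic_form[OF w])
  have uu: "x \<bullet> y = (\<Sum>i\<in>UNIV. (u $ i)\<^sup>2 / w $ i)"
    unfolding xy moment_matrix_quadratic_form[OF w] u_def ..
  \<comment> \<open>The constraint on \<open>z\<close> fixes the cross term: it is the same for
    every admissible \<open>z\<close>.\<close>
  have "x \<bullet> y = (transpose Q *v z) \<bullet> y"
    unfolding xy z y_def[symmetric] by (rule inner_commute)
  then have zu: "x \<bullet> y = (\<Sum>i\<in>UNIV. z $ i * u $ i)"
    unfolding transpose_dot u_def by (simp add: inner_vec_def)
  have "2 * (z $ i * u $ i) \<le> w $ i * (z $ i)\<^sup>2 + (u $ i)\<^sup>2 / w $ i" for i
  proof -
    have "0 \<le> (w $ i * z $ i - u $ i)\<^sup>2 / w $ i"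
      using w[of i] by simp
    also have "\<dots> = w $ i * (z $ i)\<^sup>2 + (u $ i)\<^sup>2 / w $ i - 2 * (z $ i * u $ i)"
      using w[of i] by (simp add: field_simps power2_eq_square)
    finally show ?thesis
      by simp
  qed
  then have "(\<Sum>i\<in>UNIV. 2 * (z $ i * u $ i)) \<le> (\<Sum>i\<in>UNIV. w $ i * (z $ i)\<^sup>2 + (u $ i)\<^sup>2 / w $ i)"
    by (rule sum_mono)
  then have "2 * (x \<bullet> y) \<le> (\<Sum>i\<in>UNIV. w $ i * (z $ i)\<^sup>2) + x \<bullet> y"
    by (simp add: uu[symmetric] zu[symmetric] sum.distrib flip: sum_distrib_left)
  then show ?thesis
    by (simp add: y_def)
qed

lemma information_matrix_quadratic_form_attained:
  assumes w: "\<And>i. 0 < w $ i"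
  obtains z where "transpose Q *v z = moment_matrix Q w *v (information_matrix Q w *v x)"
    "x \<bullet> (information_matrix Q w *v x) = (\<Sum>i\<in>UNIV. w $ i * (z $ i)\<^sup>2)"
proof
  define y where "y = information_matrix Q w *v x"
  \<comment> \<open>The equality case: the squares in the preceding bound vanish for this
    \<open>z\<close>.\<close>
  define z where "z = (\<chi> i. (Q *v y) $ i / w $ i)"
  show "transpose Q *v z = moment_matrix Q w *v (information_matrix Q w *v x)"
    unfolding moment_matrix_vector_mult[OF w] z_def y_def ..
  have "x \<bullet> y = y \<bullet> (moment_matrix Q w *v y)"
    unfolding y_def by (rule information_matrix_quadratic_form[OF w])
  also have "\<dots> = (\<Sum>i\<in>UNIV. w $ i * (z $ i)\<^sup>2)"
    unfolding moment_matrix_quadratic_form[OF w]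
  proof (rule sum.cong)
    show "((Q *v y) $ i)\<^sup>2 / w $ i = w $ i * (z $ i)\<^sup>2" for i
      using w[of i] by (simp add: z_def field_simps power2_eq_square)
  qed simp
  finally show "x \<bullet> (information_matrix Q w *v x) = (\<Sum>i\<in>UNIV. w $ i * (z $ i)\<^sup>2)"
    by (simp add: y_def)
qed

section \<open>Loewner bound for averaged designs\<close>

lemma nonneg_definite_scaleR:
  "0 \<le> a \<Longrightarrow> nonneg_definite H \<Longrightarrow> nonneg_definite (a *\<^sub>R H)"
  by (simp add: nonneg_definite_def transpose_scalar flip: scaleR_matrix_vector_assoc)

lemma matrix_vector_mult_sum:
  fixes F :: "'a \<Rightarrow> real ^ 'n ^ 'm"
  shows "(\<Sum>m\<in>I. F m) *v x = (\<Sum>m\<in>I. F m *v x)"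
  by (induction I rule: infinite_finite_induct) (auto simp: matrix_vector_mult_add_rdistrib)

lemma nonneg_definite_sum:
  assumes "\<And>m. m \<in> I \<Longrightarrow> nonneg_definite (F m)"
  shows "nonneg_definite (\<Sum>m\<in>I. F m)"
proof -
  have "transpose (\<Sum>m\<in>I. F m) = (\<Sum>m\<in>I. transpose (F m))"
    by (simp add: transpose_def vec_eq_iff)
  then show ?thesis
    using assms
    by (auto simp: nonneg_definite_def matrix_vector_mult_sum inner_sum_right intro!: sum_nonneg)
qed

text \<open>A minimum of functions linear in \<open>w\<close> is concave in \<open>w\<close>; this
  is the resulting Jensen inequality with equal weights, multiplied by \<open>N\<close>.\<close>

lemma information_matrix_sum_le:
  fixes w :: "nat \<Rightarrow> real ^ 'v"
  assumes w: "\<And>m i. 0 < w m $ i" and u: "\<And>i. 0 < u $ i"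
    and avg: "(\<Sum>m<N. w m) = real N *\<^sub>R u"
  shows "loewner_le (\<Sum>m<N. information_matrix Q (w m)) (real N *\<^sub>R information_matrix Q u)"
  unfolding loewner_le_def nonneg_definite_def
proof (intro conjI allI)
  have "nonneg_definite (real N *\<^sub>R information_matrix Q u)"
    by (simp add: nonneg_definite_scaleR information_matrix_nonneg_definite u)
  moreover have "nonneg_definite (\<Sum>m<N. information_matrix Q (w m))"
    by (simp add: nonneg_definite_sum information_matrix_nonneg_definite w)
  ultimately show "transpose (real N *\<^sub>R information_matrix Q u - (\<Sum>m<N. information_matrix Q (w m))) =
      real N *\<^sub>R information_matrix Q u - (\<Sum>m<N. information_matrix Q (w m))"
    by (simp add: nonneg_definite_def transpose_def vec_eq_iff)
next
  fix x
  obtain z where z: "transpose Q *v z = moment_matrix Q u *v (information_matrix Q u *v x)"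
    "x \<bullet> (information_matrix Q u *v x) = (\<Sum>i\<in>UNIV. u $ i * (z $ i)\<^sup>2)"
    by (rule information_matrix_quadratic_form_attained[OF u])
  have "x \<bullet> (information_matrix Q (w m) *v x) \<le> (\<Sum>i\<in>UNIV. w m $ i * (z $ i)\<^sup>2)" for m
  proof (rule information_matrix_le_quadratic_form[OF w])
    \<comment> \<open>The minimizer for \<open>u\<close> is admissible for every \<open>w m\<close>
      because the projection is the same for all positive designs.\<close>
    show "transpose Q *v z = moment_matrix Q (w m) *v (information_matrix Q (w m) *v x)"
      unfolding z matrix_vector_mul_assoc
      using moment_information_projection_eq[OF w u, of Q] by simp
  qed
  then have "(\<Sum>m<N. x \<bullet> (information_matrix Q (w m) *v x)) \<le>
      (\<Sum>m<N. \<Sum>i\<in>UNIV. w m $ i * (z $ i)\<^sup>2)"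
    by (rule sum_mono)
  also have "\<dots> = (\<Sum>i\<in>UNIV. (\<Sum>m<N. w m) $ i * (z $ i)\<^sup>2)"
    by (subst sum.swap) (simp add: sum_distrib_right)
  also have "\<dots> = real N * (x \<bullet> (information_matrix Q u *v x))"
    by (simp add: avg z sum_distrib_left mult.assoc)
  finally show "0 \<le> x \<bullet> ((real N *\<^sub>R information_matrix Q u -
      (\<Sum>m<N. information_matrix Q (w m))) *v x)"
    by (simp add: matrix_vector_mult_diff_rdistrib inner_diff_right matrix_vector_mult_sum
        inner_sum_right flip: scaleR_matrix_vector_assoc)
qed

section \<open>Symmetry\<close>

text \<open>The image of the edge of column \<open>k\<close> is again an edge, whose column is
  \<open>\<sigma> k\<close>. As edges are directed, signs are preserved too.\<close>

lemma automorphism_permutes_columns: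
  fixes Q :: "real ^ 's ^ 'v"
  assumes Q: "pairwise_comparisons Q" and \<pi>: "graph_automorphism (comparison_edges Q) \<pi>"
  obtains \<sigma> where "bij \<sigma>" "\<And>i k. Q $ \<pi> i $ \<sigma> k = Q $ i $ k"
proof -
  have inj\<pi>: "inj \<pi>"
    using \<pi> by (auto simp: graph_automorphism_def bij_def)
  have column: "\<exists>i j. is_comparison (column k Q) j i" for k
    using Q by (simp add: pairwise_comparisons_def)
  have "\<exists>l. \<forall>i. Q $ \<pi> i $ l = Q $ i $ k" for k
  proof -
    obtain i j where ij: "is_comparison (column k Q) j i"
      using column by blast
    then have "(j, i) \<in> comparison_edges Q"
      by (auto simp: comparison_edges_def)
    then have "(\<pi> j, \<pi> i) \<in> comparison_edges Q"
      using \<pi> by (simp add: graph_automorphism_def)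
    then obtain l where l: "is_comparison (column l Q) (\<pi> j) (\<pi> i)"
      by (auto simp: comparison_edges_def)
    have "Q $ \<pi> a $ l = Q $ a $ k" for a
    proof -
      have "column l Q $ \<pi> a = column k Q $ a"
        using ij l inj\<pi> by (simp add: is_comparison_def axis_def inj_eq)
      then show ?thesis
        by (simp add: column_def)
    qed
    then show ?thesis
      by blast
  qed
  then obtain \<sigma> where \<sigma>: "\<And>i k. Q $ \<pi> i $ \<sigma> k = Q $ i $ k"
    by metis
  have "inj \<sigma>"
  \<comment> \<open>Equal images would force equal columns \<open>k\<close> and \<open>l\<close>,
    but distinct columns belong to distinct unordered pairs.\<close>
  proof (rule injI, rule ccontr)
    fix k l assume "\<sigma> k = \<sigma> l" "k \<noteq> l"
    then have "column k Q = column l Q"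
      by (simp add: column_def) (metis \<sigma>)
    moreover obtain i j where "is_comparison (column k Q) j i"
      using column by blast
    ultimately show False
      using conjunct1[OF conjunct2[OF Q[unfolded pairwise_comparisons_def]]] \<open>k \<noteq> l\<close> by metis
  qed
  then have "bij \<sigma>"
    by (simp add: bij_def finite_UNIV_inj_surj)
  then show thesis
    using \<sigma> that by blast
qed

lemma orthogonal_matrix_permutation:
  fixes \<sigma> :: "'s :: finite \<Rightarrow> 's"
  assumes "bij \<sigma>"
  shows "orthogonal_matrix ((\<chi> k l. if l = \<sigma> k then 1 else 0) :: real ^ 's ^ 's)"
proof -
  let ?U = "(\<chi> k l. if l = \<sigma> k then 1 else 0) :: real ^ 's ^ 's"
  have "?U ** transpose ?U = mat 1"
    using assms
    by (simp add: matrix_matrix_mult_def transpose_def mat_def vec_eq_iff bij_def inj_eq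
        if_distrib[of "\<lambda>c. c * _"] cong: if_cong)
  then show ?thesis
    unfolding orthogonal_matrix by (rule matrix_left_right_inverse[THEN iffD1])
qed

text \<open>Reindexing the entry sums by \<open>\<pi>\<close> shows that shifting the weights
  permutes rows and columns of the moment matrix by \<open>\<sigma>\<close>; uniqueness carries this
  over to the pseudoinverse.\<close>

lemma information_matrix_permute:
  fixes Q :: "real ^ 's ^ 'v"
  assumes "bij \<pi>" "bij \<sigma>" and Q: "\<And>i k. Q $ \<pi> i $ \<sigma> k = Q $ i $ k" and w: "\<And>i. 0 < w $ i"
  obtains U where "orthogonal_matrix U"
    "information_matrix Q (\<chi> i. w $ \<pi> i) = U ** information_matrix Q w ** transpose U"
proof
  \<comment> \<open>Entry \<open>k\<close>, \<open>l\<close> of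
    \<open>?U ** H ** transpose ?U\<close> is \<open>H $ \<sigma> k $ \<sigma> l\<close>.\<close>
  let ?U = "(\<chi> k l. if l = \<sigma> k then 1 else 0) :: real ^ 's ^ 's"
  show U: "orthogonal_matrix ?U"
    using assms(2) by (rule orthogonal_matrix_permutation)
  have wp: "0 < (\<chi> i. w $ \<pi> i) $ i" for i
    by (simp add: w)
  have "moment_matrix Q (\<chi> i. w $ \<pi> i) $ k $ l = moment_matrix Q w $ \<sigma> k $ \<sigma> l" for k l
    unfolding moment_matrix_entry[OF wp] moment_matrix_entry[OF w]
    using sum.reindex_bij_betw[OF assms(1), of "\<lambda>i. Q $ i $ \<sigma> k * Q $ i $ \<sigma> l / w $ i"]
    by (simp add: Q)
  then have "moment_matrix Q (\<chi> i. w $ \<pi> i) = ?U ** moment_matrix Q w ** transpose ?U"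
    by (simp add: vec_eq_iff matrix_matrix_mult_def transpose_def if_distrib if_distribR cong: if_cong)
  then show "information_matrix Q (\<chi> i. w $ \<pi> i) = ?U ** information_matrix Q w ** transpose ?U"
    using is_pseudoinverse_unique[OF information_matrix_is_pseudoinverse[OF wp, of Q]]
      is_pseudoinverse_orthogonal_similar[OF U information_matrix_is_pseudoinverse[OF w, of Q]]
    by simp
qed

section \<open>Averaging a design over the powers of a cyclic permutation\<close>

lemma cyclic_permutation_period:
  assumes "cyclic_permutation \<pi>"
  obtains N where "0 < N" "\<pi> ^^ N = id"
proof -
  fix i
  \<comment> \<open>Starting at \<open>\<pi> i\<close> makes the period \<open>Suc m\<close>
    positive even if \<open>m\<close> is zero. Since every point is a power of \<open>\<pi>\<close>
    applied to \<open>i\<close>, this power fixes them all.\<close>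
  obtain m where m: "(\<pi> ^^ m) (\<pi> i) = i"
    using assms by (auto simp: cyclic_permutation_def)
  have "(\<pi> ^^ Suc m) j = j" for j
  proof -
    obtain k where "j = (\<pi> ^^ k) i"
      using assms by (metis cyclic_permutation_def)
    then have "(\<pi> ^^ Suc m) j = (\<pi> ^^ k) ((\<pi> ^^ Suc m) i)"
      by (metis add.commute comp_apply funpow_add)
    then show ?thesis
      using m \<open>j = _\<close> by (simp add: funpow_swap1)
  qed
  then have "\<pi> ^^ Suc m = id"
    by (intro ext) (simp only: id_apply)
  then show thesis
    by (rule that[rotated]) simp
qed

text \<open>The sum along \<open>N\<close> shifts is invariant under \<open>\<pi>\<close>, hence
  constant on the single cycle; the total weight determines the constant.\<close>

lemma cyclic_average:
  fixes w :: "real ^ 'v"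
  assumes \<pi>: "cyclic_permutation \<pi>" and N: "\<pi> ^^ N = id" and w: "(\<Sum>i\<in>UNIV. w $ i) = 1"
  shows "(\<Sum>m<N. \<chi> i. w $ (\<pi> ^^ m) i) = real N *\<^sub>R uniform_design"
proof -
  define h where "h i = (\<Sum>m<N. w $ (\<pi> ^^ m) i)" for i
  have step: "h (\<pi> i) = h i" for i
  proof -
    \<comment> \<open>Splitting off the last term instead of the first gives \<open>h i\<close> plus
      the weight at \<open>(\<pi> ^^ N) i\<close>, which is \<open>w $ i\<close> again.\<close>
    have "h (\<pi> i) + w $ i = (\<Sum>m<Suc N. w $ (\<pi> ^^ m) i)"
      by (subst sum.lessThan_Suc_shift) (simp add: h_def funpow_swap1)
    then show ?thesis
      by (simp add: h_def N)
  qed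
  have "h ((\<pi> ^^ m) i) = h i" for m i
    by (induction m) (auto simp: step)
  then have const: "h i = h j" for i j
    using \<pi> unfolding cyclic_permutation_def by metis
  have "(\<Sum>i\<in>UNIV. h i) = (\<Sum>m<N. \<Sum>i\<in>UNIV. w $ (\<pi> ^^ m) i)"
    unfolding h_def by (rule sum.swap)
  also have "\<dots> = (\<Sum>m<N. 1)"
  proof (rule sum.cong)
    fix m
    have "bij (\<pi> ^^ m)"
      using \<pi> by (simp add: cyclic_permutation_def bij_fn)
    then show "(\<Sum>i\<in>UNIV. w $ (\<pi> ^^ m) i) = 1"
      using sum.reindex_bij_betw[of "\<pi> ^^ m" UNIV UNIV "($) w"] w by simp
  qed simp
  finally have sum: "(\<Sum>i\<in>UNIV. h i) = real N"
    by simp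
  have "real CARD('v) * h j = real N" for j
  proof -
    have "(\<Sum>i\<in>UNIV. h i) = (\<Sum>i\<in>(UNIV :: 'v set). h j)"
      by (rule sum.cong[OF refl]) (rule const)
    then show ?thesis
      by (simp add: sum)
  qed
  then have "h j = real N / real CARD('v)" for j
    by (simp add: field_simps)
  then show ?thesis
    by (simp add: vec_eq_iff uniform_design_def h_def)
qed

section \<open>Information functions of finite sums, and optimality\<close>

text \<open>Homogeneity with factor 2 forces this; it starts the induction for finite
  superadditivity at the empty sum.\<close>

lemma information_function_zero:
  assumes "information_function \<Phi>"
  shows "\<Phi> 0 = 0"
proof -
  have "nonneg_definite 0"
    by (simp add: nonneg_definite_def transpose_def vec_eq_iff)
  then have "\<Phi> (2 *\<^sub>R 0) = 2 * \<Phi> 0"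
    using assms unfolding information_function_def by (meson zero_less_numeral)
  then show ?thesis
    by simp
qed

lemma information_function_sum:
  assumes \<Phi>: "information_function \<Phi>" and F: "\<And>m. m \<in> I \<Longrightarrow> nonneg_definite (F m)"
  shows "(\<Sum>m\<in>I. \<Phi> (F m)) \<le> \<Phi> (\<Sum>m\<in>I. F m)"
  using F
proof (induction I rule: infinite_finite_induct)
  case (insert a I)
  then have "\<Phi> (F a) + \<Phi> (\<Sum>m\<in>I. F m) \<le> \<Phi> (F a + (\<Sum>m\<in>I. F m))"
    using \<Phi> by (simp add: information_function_def nonneg_definite_sum)
  with insert show ?case
    by simp
qed (auto simp: information_function_zero[OF \<Phi>])

theorem theorem4:
  fixes Q :: "real ^ 's ^ 'v" and \<pi> :: "'v \<Rightarrow> 'v" and \<Phi> :: "real ^ 's ^ 's \<Rightarrow> real"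
  assumes "pairwise_comparisons Q"
    and "cyclic_permutation \<pi>"
    and "graph_automorphism (comparison_edges Q) \<pi>"
    and "information_function \<Phi>"
    and "orthogonally_invariant \<Phi>"
  shows "optimal_design \<Phi> Q uniform_design"
  unfolding optimal_design_def
proof (intro conjI allI impI)
  show "positive_design (uniform_design :: real ^ 'v)"
    by (simp add: positive_design_def design_def uniform_design_def)
  have u: "0 < (uniform_design :: real ^ 'v) $ i" for i
    by (simp add: uniform_design_def)
  fix w :: "real ^ 'v"
  assume w: "positive_design w"
  then have pos: "\<And>i. 0 < w $ i" and sum: "(\<Sum>i\<in>UNIV. w $ i) = 1"
    by (auto simp: positive_design_def design_def)
  have bij: "bij \<pi>"
    using assms(2) by (simp add: cyclic_permutation_def)
  obtain N where N: "0 < N" "\<pi> ^^ N = id"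
    using cyclic_permutation_period[OF assms(2)] .
  obtain \<sigma> where \<sigma>: "bij \<sigma>" "\<And>i k. Q $ \<pi> i $ \<sigma> k = Q $ i $ k"
    using automorphism_permutes_columns[OF assms(1,3)] by blast
  define W where "W m = (\<chi> i. w $ (\<pi> ^^ m) i)" for m
  have W: "0 < W m $ i" for m i
    by (simp add: W_def pos)
  let ?C = "information_matrix Q"
  \<comment> \<open>Each further shift by \<open>\<pi>\<close> conjugates the information matrix
    orthogonally, which \<Phi> does not see.\<close>
  have \<Phi>W: "\<Phi> (?C (W m)) = \<Phi> (?C w)" for m
  proof (induction m)
    case 0
    show ?case
      by (simp add: W_def)
  next
    case (Suc m)
    obtain U where "orthogonal_matrix U" "?C (\<chi> i. W m $ \<pi> i) = U ** ?C (W m) ** transpose U"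
      by (rule information_matrix_permute[OF bij \<sigma> W])
    moreover have "W (Suc m) = (\<chi> i. W m $ \<pi> i)"
      by (simp add: W_def vec_eq_iff funpow_swap1)
    ultimately show ?case
      using assms(5) Suc information_matrix_nonneg_definite[OF W, of Q m]
      by (simp add: orthogonally_invariant_def)
  qed
  have nn: "nonneg_definite (\<Sum>m<N. ?C (W m))" "nonneg_definite (?C uniform_design)"
    by (simp_all add: nonneg_definite_sum information_matrix_nonneg_definite W u)
  have avg: "(\<Sum>m<N. W m) = real N *\<^sub>R uniform_design"
    unfolding W_def by (rule cyclic_average[OF assms(2) N(2) sum])
  \<comment> \<open>The chain uses superadditivity, Loewner isotonicity and homogeneity in turn;
    \<open>0 < N\<close> allows the last of these and the final cancellation.\<close>
  have "real N * \<Phi> (?C w) = (\<Sum>m<N. \<Phi> (?C (W m)))"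
    by (simp add: \<Phi>W)
  also have "\<dots> \<le> \<Phi> (\<Sum>m<N. ?C (W m))"
    by (rule information_function_sum[OF assms(4)]) (rule information_matrix_nonneg_definite[OF W])
  also have "\<dots> \<le> \<Phi> (real N *\<^sub>R ?C uniform_design)"
    using information_matrix_sum_le[OF W u avg, of Q] nn assms(4)
    by (simp add: information_function_def nonneg_definite_scaleR)
  also have "\<dots> = real N * \<Phi> (?C uniform_design)"
    using nn(2) assms(4) N(1) by (simp add: information_function_def)
  finally show "\<Phi> (?C w) \<le> \<Phi> (?C uniform_design)"
    using N(1) by simp
qed

end
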